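(* For every $n\ge 1$, all roots of the polynomial $\mathrm{G}(s,S_n(1))$ have real part $-1/2$. If $\alpha_n$ is a root of $\mathrm{G}(s,S_n(1))$ with maximal norm (absolute value), then $$\left|\alpha_n+\frac12\right|=\frac{n(n+2)}{2\pi}+o(n)$$ as $n$ tends to infinity.
   Context: $S_n(1)=\mathrm{conv}\{e_1,\dots,e_n,-\sum_{i=1}^n e_i\}\subset\mathbb{R}^n$, where $e_i$ is the $i$-th unit vector. For a lattice polytope $P\subset\mathbb{R}^n$ (vertices in $\mathbb{Z}^n$, $\dim P=n$) the number of lattice points $\#(kP\cap\mathbb{Z}^n)$ is, for $k\in\mathbb{N}$, a polynomial $\sum_{i=0}^n \mathrm{G}_i(P)k^i$ of degree $n$ in $k$ (the Ehrhart polynomial); $\mathrm{G}(s,P)=\sum_{i=0}^n\mathrm{G}_i(P)s^i$ denotes this polynomial as a polynomial in a complex variable $s$. *)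

theory Defs
  imports
    "HOL-Analysis.Analysis"
    "HOL-Computational_Algebra.Computational_Algebra"
    "HOL-Library.Function_Algebras"
    "HOL-Library.Landau_Symbols"
begin

text \<open>
  Since the dimension \<open>n\<close> varies inside the statement, \<open>\<real>\<^sup>n\<close> is realised as the subspace of
  those functions \<open>nat \<Rightarrow> real\<close> that vanish outside \<open>{1..n}\<close>. The pointwise vector space
  structure below makes the library's convex hull available there.
\<close>

instantiation "fun" :: (type, real_vector) real_vector
begin

definition scaleR_fun :: "real \<Rightarrow> ('a \<Rightarrow> 'b) \<Rightarrow> 'a \<Rightarrow> 'b" where
  "scaleR_fun c f = (\<lambda>x. c *\<^sub>R f x)"

instance
  by standard (simp_all add: scaleR_fun_def fun_eq_iff scaleR_add_right scaleR_add_left)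

end

definition real_space :: "nat \<Rightarrow> (nat \<Rightarrow> real) set" where
  "real_space n = {x. \<forall>i. i \<notin> {1..n} \<longrightarrow> x i = 0}"

definition int_lattice :: "nat \<Rightarrow> (nat \<Rightarrow> real) set" where
  "int_lattice n = {x \<in> real_space n. \<forall>i. x i \<in> \<int>}"

definition unit_vec :: "nat \<Rightarrow> nat \<Rightarrow> real" where
  "unit_vec i = (\<lambda>j. if j = i then 1 else 0)"

definition lattice_count :: "nat \<Rightarrow> (nat \<Rightarrow> real) set \<Rightarrow> nat \<Rightarrow> nat" where
  "lattice_count n P k = card ((\<lambda>x. real k *\<^sub>R x) ` P \<inter> int_lattice n)"

text \<open>
  Only positive dilation factors are used, so that the definition does not depend on whether
  \<open>0\<close> counts as a natural number; infinitely many values determine the polynomial anyway.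
\<close>

definition ehrhart_poly :: "nat \<Rightarrow> (nat \<Rightarrow> real) set \<Rightarrow> complex poly" where
  "ehrhart_poly n P =
     (THE p. \<forall>k\<ge>1. poly p (of_nat k) = of_nat (lattice_count n P k))"

lemma ehrhart_poly_eqI:
  assumes "\<And>k. k \<ge> 1 \<Longrightarrow> poly p (of_nat k) = of_nat (lattice_count n P k)"
  shows "ehrhart_poly n P = p"
  unfolding ehrhart_poly_def
proof (rule the_equality)
  show "\<forall>k\<ge>1. poly p (of_nat k) = of_nat (lattice_count n P k)"
    using assms by blast
next
  fix q :: "complex poly"
  assume q: "\<forall>k\<ge>1. poly q (of_nat k) = of_nat (lattice_count n P k)"
  have sub: "of_nat ` {1..} \<subseteq> {x. poly (q - p) x = 0}"
    using q assms by auto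
  have "infinite (of_nat ` {1::nat..} :: complex set)"
    by (subst finite_image_iff) (auto simp: inj_on_def infinite_Ici)
  then have "infinite {x. poly (q - p) x = 0}"
    using sub finite_subset by blast
  then show "q = p"
    using poly_roots_finite[of "q - p"] by auto
qed

definition S1 :: "nat \<Rightarrow> (nat \<Rightarrow> real) set" where
  "S1 n = convex hull (unit_vec ` {1..n} \<union> {- (\<Sum>i=1..n. unit_vec i)})"

definition max_norm_root :: "complex poly \<Rightarrow> complex \<Rightarrow> bool" where
  "max_norm_root p z \<longleftrightarrow> poly p z = 0 \<and> (\<forall>w. poly p w = 0 \<longrightarrow> cmod w \<le> cmod z)"

end

theory Submission
  imports Defs
begin

text \<open>
  A point of the \<open>k\<close>-th dilate of the simplex has barycentric coordinates, nonnegative numbers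
  \<open>c 0, \<dots>, c n\<close> with sum \<open>k\<close>, and the point itself only depends on the differences of these
  numbers. Subtracting the minimum turns lattice points into integer vectors
  \<open>(y 0, \<dots>, y n)\<close> with minimum \<open>0\<close> and sum at most \<open>k\<close>. All nonnegative integer vectors with sum at
  most \<open>k\<close>, without those that have only positive entries, give the count
  \<open>(k + n + 1 choose n + 1) - (k choose n + 1)\<close> (lemma \<open>lattice_count_S1\<close>). Hence \<open>s\<close> is a root of
  the Ehrhart polynomial if and only if the products of \<open>s + 1 + j\<close> and of \<open>s - j\<close> over
  \<open>0 \<le> j \<le> n\<close> agree.

  If \<open>Re s \<noteq> -1/2\<close>, then all factors of one product are larger in absolute value than the
  corresponding factors of the other, so all roots lie on the line \<open>Re s = -1/2\<close>
  (lemma \<open>ehrhart_S1_root_Re\<close>).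

  At \<open>s = -1/2 + \<i> t\<close> with \<open>t > 0\<close> the two products are complex conjugates of each other up to a
  common factor, and the root condition says that the sum of \<open>arctan ((j + 1/2) / t)\<close> over
  \<open>0 \<le> j \<le> n\<close> is a multiple of \<open>\<pi>\<close> (lemma \<open>ehrhart_S1_root_iff_sin_phase\<close>). This sum decreases to \<open>0\<close>
  as \<open>t\<close> grows, so the largest root is where it equals \<open>\<pi>\<close>. Replacing \<open>arctan x\<close> by \<open>x\<close> makes the sum
  \<open>(n + 1)\<^sup>2 / (2 t)\<close>, which equals \<open>\<pi>\<close> at \<open>T = (n + 1)\<^sup>2 / (2 \<pi>)\<close>. The bounds \<open>x - x\<^sup>3 / 3 \<le> arctan x \<le> x\<close> for
  \<open>x \<ge> 0\<close> show that the largest \<open>t\<close> lies between \<open>T - 2\<close> and \<open>T\<close> as soon as \<open>T \<ge> 8\<close>. Therefore the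
  error in the asymptotic formula is even bounded (lemma \<open>max_norm_root_S1_estimate\<close>).
\<close>

section \<open>The dilated simplex in barycentric coordinates\<close>

text \<open>
  The parameters \<open>c 0, \<dots>, c n\<close> are unnormalised barycentric coordinates: the point is
  \<open>c 1 e\<^sub>1 + \<dots> + c n e\<^sub>n - c 0 (e\<^sub>1 + \<dots> + e\<^sub>n)\<close>. It is unchanged when the same number is added to
  all of them.
\<close>

definition simplex_point :: "nat \<Rightarrow> (nat \<Rightarrow> real) \<Rightarrow> nat \<Rightarrow> real" where
  "simplex_point n c = (\<lambda>i. if i \<in> {1..n} then c i - c 0 else 0)"

lemma sum_fun_eval: "(\<Sum>i\<in>A. f i) x = (\<Sum>i\<in>A. f i x :: 'b::comm_monoid_add)"
  by (induction A rule: infinite_finite_induct) (auto simp: plus_fun_def zero_fun_def)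

lemma S1_eq:
  "S1 n = {simplex_point n c | c. (\<forall>i\<le>n. 0 \<le> c i) \<and> (\<Sum>i\<le>n. c i) = 1}" (is "_ = ?R")
proof
  show "S1 n \<subseteq> ?R"
    unfolding S1_def
  proof (rule hull_minimal)
    show "unit_vec ` {1..n} \<union> {- (\<Sum>i = 1..n. unit_vec i)} \<subseteq> ?R"
    proof
      fix x assume "x \<in> unit_vec ` {1..n} \<union> {- (\<Sum>i = 1..n. unit_vec i)}"
      then consider i where "i \<in> {1..n}" "x = unit_vec i" | "x = - (\<Sum>i = 1..n. unit_vec i)"
        by auto
      then show "x \<in> ?R"
      proof cases
        case 1
        then have "x = simplex_point n (unit_vec i)" "(\<forall>j\<le>n. 0 \<le> unit_vec i j)"
            "(\<Sum>j\<le>n. unit_vec i j) = 1"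
          by (auto simp: simplex_point_def unit_vec_def fun_eq_iff)
        then show ?thesis by blast
      next
        case 2
        have "x = simplex_point n (unit_vec 0)"
          unfolding 2
          by (auto simp: simplex_point_def unit_vec_def fun_eq_iff sum_fun_eval)
        moreover have "(\<forall>j\<le>n. 0 \<le> unit_vec 0 j)" "(\<Sum>j\<le>n. unit_vec 0 j) = 1"
          by (auto simp: unit_vec_def)
        ultimately show ?thesis by blast
      qed
    qed
    show "convex ?R"
    proof (rule convexI)
      fix x y and u v :: real
      assume "x \<in> ?R" "y \<in> ?R" and uv: "0 \<le> u" "0 \<le> v" "u + v = 1"
      then obtain c d where c: "x = simplex_point n c" "\<forall>i\<le>n. 0 \<le> c i" "(\<Sum>i\<le>n. c i) = 1"
        and d: "y = simplex_point n d" "\<forall>i\<le>n. 0 \<le> d i" "(\<Sum>i\<le>n. d i) = 1"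
        by blast
      let ?e = "\<lambda>i. u * c i + v * d i"
      have "u *\<^sub>R x + v *\<^sub>R y = simplex_point n ?e"
        by (auto simp: c d simplex_point_def fun_eq_iff scaleR_fun_def algebra_simps)
      moreover have "\<forall>i\<le>n. 0 \<le> ?e i" using c d uv by auto
      moreover have "(\<Sum>i\<le>n. ?e i) = 1"
        using c d uv by (simp add: sum.distrib flip: sum_distrib_left)
      ultimately show "u *\<^sub>R x + v *\<^sub>R y \<in> ?R" by blast
    qed
  qed
next
  let ?v = "\<lambda>i. if i = 0 then - (\<Sum>i=1..n. unit_vec i) else unit_vec i"
  show "?R \<subseteq> S1 n"
  proof clarify
    fix c :: "nat \<Rightarrow> real"
    assume c: "\<forall>i\<le>n. 0 \<le> c i" "(\<Sum>i\<le>n. c i) = 1"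
    have "(\<Sum>i\<le>n. c i *\<^sub>R ?v i) \<in> S1 n"
    proof (rule convex_sum)
      show "convex (S1 n)" by (simp add: S1_def)
      show "?v i \<in> S1 n" if "i \<in> {..n}" for i
        unfolding S1_def using that by (intro hull_inc) auto
    qed (use c in auto)
    also have "(\<Sum>i\<le>n. c i *\<^sub>R ?v i) = simplex_point n c"
    proof
      fix j
      have "(\<Sum>i\<le>n. c i *\<^sub>R ?v i) j = (\<Sum>i\<le>n. c i * ?v i j)"
        by (auto simp: sum_fun_eval scaleR_fun_def intro!: sum.cong)
      also have "\<dots> = (\<Sum>i\<in>insert 0 {1..n}. c i * ?v i j)"
        by (rule sum.cong) auto
      also have "\<dots> = c 0 * ?v 0 j + (\<Sum>i\<in>{1..n}. c i * ?v i j)"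
        by (rule sum.insert) auto
      also have "(\<Sum>i\<in>{1..n}. c i * ?v i j) = (\<Sum>i\<in>{1..n}. if i = j then c i else 0)"
        by (rule sum.cong) (auto simp: unit_vec_def)
      also have "c 0 * ?v 0 j = (if j \<in> {1..n} then - c 0 else 0)"
        by (auto simp: sum_fun_eval unit_vec_def)
      finally show "(\<Sum>i\<le>n. c i *\<^sub>R ?v i) j = simplex_point n c j"
        by (auto simp: simplex_point_def)
    qed
    finally show "simplex_point n c \<in> S1 n" .
  qed
qed

lemma dilate_S1_eq:
  assumes "k \<ge> 1"
  shows "(\<lambda>x. real k *\<^sub>R x) ` S1 n =
    {simplex_point n c | c. (\<forall>i\<le>n. 0 \<le> c i) \<and> (\<Sum>i\<le>n. c i) = real k}" (is "?L = ?R")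
proof (intro subset_antisym subsetI)
  fix x assume "x \<in> ?L"
  then obtain c where c: "x = real k *\<^sub>R simplex_point n c" "\<forall>i\<le>n. 0 \<le> c i" "(\<Sum>i\<le>n. c i) = 1"
    unfolding S1_eq by blast
  have "x = simplex_point n (\<lambda>i. real k * c i)"
    by (auto simp: c simplex_point_def fun_eq_iff scaleR_fun_def algebra_simps)
  moreover have "(\<Sum>i\<le>n. real k * c i) = real k" "\<forall>i\<le>n. 0 \<le> real k * c i"
    using c by (auto simp flip: sum_distrib_left)
  ultimately show "x \<in> ?R" by blast
next
  fix x assume "x \<in> ?R"
  then obtain c where c: "x = simplex_point n c" "\<forall>i\<le>n. 0 \<le> c i" "(\<Sum>i\<le>n. c i) = real k"
    by blast
  have "x = real k *\<^sub>R simplex_point n (\<lambda>i. c i / real k)"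
    using assms by (auto simp: c simplex_point_def fun_eq_iff scaleR_fun_def field_simps)
  moreover have "(\<Sum>i\<le>n. c i / real k) = 1" "\<forall>i\<le>n. 0 \<le> c i / real k"
    using c assms by (auto simp flip: sum_divide_distrib)
  ultimately show "x \<in> ?L" unfolding S1_eq by blast
qed

section \<open>Counting lattice points by weak compositions\<close>

definition weak_compositions :: "nat \<Rightarrow> nat \<Rightarrow> nat list set" where
  "weak_compositions m k = {l. length l = m \<and> sum_list l = k}"

lemma card_weak_compositions:
  "card (weak_compositions (Suc m) k) = (k + m) choose k"
  unfolding weak_compositions_def using card_length_sum_list[of "Suc m" k] by simp

lemma finite_weak_compositions [simp]: "finite (weak_compositions m k)"
proof (rule finite_subset)
  show "weak_compositions m k \<subseteq> {l. set l \<subseteq> {..k} \<and> length l = m}"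
    by (auto simp: weak_compositions_def member_le_sum_list)
  show "finite {l::nat list. set l \<subseteq> {..k} \<and> length l = m}"
    by (rule finite_lists_length_eq) simp
qed

lemma sum_list_split_last:
  assumes "length l = n + 2"
  shows "sum_list l = (\<Sum>i\<le>n. l ! i) + (l ! Suc n :: nat)"
  using assms by (simp add: sum_list_sum_nth atLeast0LessThan lessThan_Suc_atMost)

text \<open>
  The entries \<open>0, \<dots>, n\<close> of a list serve as barycentric coordinates of a lattice point; the
  last entry is the slack \<open>k - (l ! 0 + \<dots> + l ! n)\<close>. Coordinates of a point are only
  determined up to a common summand, and requiring the minimum to be \<open>0\<close> selects one choice,
  which is integral exactly at lattice points. Distributing the slack evenly over the
  \<open>n + 1\<close> coordinates brings their sum back to \<open>k\<close>, so the point lies in the dilate. Conversely,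
  subtracting the minimum from nonnegative coordinates with sum \<open>k\<close> leaves a sum of at most \<open>k\<close>.
\<close>

lemma lattice_points_dilate_S1:
  assumes "k \<ge> 1"
  shows "bij_betw (\<lambda>l. simplex_point n (\<lambda>i. real (l ! i)))
    {l \<in> weak_compositions (n + 2) k. \<exists>i\<le>n. l ! i = 0}
    ((\<lambda>x. real k *\<^sub>R x) ` S1 n \<inter> int_lattice n)" (is "bij_betw ?f ?A ?B")
proof (rule bij_betw_imageI)
  show "inj_on ?f ?A"
  proof (rule inj_onI)
    fix l m assume l: "l \<in> ?A" and m: "m \<in> ?A" and eq: "?f l = ?f m"
    have len: "length l = n + 2" "length m = n + 2"
      and sums: "sum_list l = k" "sum_list m = k"
      using l m by (auto simp: weak_compositions_def)
    (* Equal points have coordinates that differ by a common summand; two zero minima make it 0. *)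
    have diff: "real (l ! i) - real (l ! 0) = real (m ! i) - real (m ! 0)" if "i \<le> n" for i
      using fun_cong[OF eq, of i] that by (cases "i = 0") (auto simp: simplex_point_def)
    obtain p q where p: "p \<le> n" "l ! p = 0" and q: "q \<le> n" "m ! q = 0"
      using l m by auto
    have "l ! 0 = m ! 0"
      using diff[OF p(1)] diff[OF q(1)] p q by linarith
    then have ent: "l ! i = m ! i" if "i \<le> n" for i
      using diff[OF that] by simp
    then have "l ! Suc n = m ! Suc n"
      using sums sum_list_split_last[OF len(1)] sum_list_split_last[OF len(2)] by simp
    with ent show "l = m"
      using len by (intro nth_equalityI) (auto simp: less_Suc_eq_le le_Suc_eq)
  qed
  show "?f ` ?A = ?B"
  proof (intro subset_antisym subsetI)
    fix x assume "x \<in> ?f ` ?A"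
    then obtain l where len: "length l = n + 2" and sums: "sum_list l = k" and x: "x = ?f l"
      by (auto simp: weak_compositions_def)
    let ?c = "\<lambda>i. real (l ! i) + real (l ! Suc n) / real (n + 1)"
    have "x = simplex_point n ?c"
      by (auto simp: x simplex_point_def)
    moreover have "(\<Sum>i\<le>n. ?c i) = real k"
    proof -
      have "(\<Sum>i\<le>n. ?c i) = real (\<Sum>i\<le>n. l ! i) + real (l ! Suc n)"
        using of_nat_0_less_iff[of "n + 1", where ?'a = real] by (simp add: sum.distrib)
      then show ?thesis
        using sum_list_split_last[OF len] sums by simp
    qed
    ultimately have "x \<in> (\<lambda>x. real k *\<^sub>R x) ` S1 n"
      unfolding dilate_S1_eq[OF assms]
      by (intro CollectI exI[of _ ?c]) auto
    moreover have "x \<in> int_lattice n"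
      by (auto simp: x int_lattice_def real_space_def simplex_point_def)
    ultimately show "x \<in> ?B" by blast
  next
    fix x assume "x \<in> ?B"
    then obtain c where x: "x = simplex_point n c" and c0: "\<forall>i\<le>n. 0 \<le> c i"
      and cs: "(\<Sum>i\<le>n. c i) = real k" and int: "x \<in> int_lattice n"
      unfolding dilate_S1_eq[OF assms] by blast
    define z where "z = (\<lambda>i. \<lfloor>x i\<rfloor>)"
    have z: "x i = of_int (z i)" for i
      using int by (auto simp: int_lattice_def z_def elim!: Ints_cases)
    (* Passing from c to y subtracts the minimum of the coordinates, attained at index p. *)
    define M where "M = Max ((\<lambda>i. - z i) ` {..n})"
    have M_ge: "- z i \<le> M" if "i \<le> n" for i
      unfolding M_def using that by (intro Max_ge) auto
    have "M \<in> (\<lambda>i. - z i) ` {..n}" unfolding M_def by (intro Max_in) auto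
    then obtain p where p: "p \<le> n" "M = - z p" by auto
    define y where "y = (\<lambda>i. nat (z i + M))"
    have y: "int (y i) = z i + M" if "i \<le> n" for i
      using M_ge[OF that] by (simp add: y_def)
    have xc: "x i = c i - c 0" if "i \<le> n" for i
      using that by (cases "i = 0") (auto simp: x simplex_point_def)
    have yc: "real (y i) = c i - c p" if "i \<le> n" for i
    proof -
      have "real (y i) = of_int (int (y i))" by simp
      also have "\<dots> = x i - x p" using y[OF that] p z by simp
      finally show ?thesis using xc that p by simp
    qed
    have "real (\<Sum>i\<le>n. y i) \<le> real k"
      unfolding cs[symmetric] of_nat_sum by (rule sum_mono) (use yc c0 p in auto)
    then have le: "(\<Sum>i\<le>n. y i) \<le> k" by linarith
    define l where "l = map y [0..<Suc n] @ [k - (\<Sum>i\<le>n. y i)]"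
    have len: "length l = n + 2" by (simp add: l_def)
    have ly: "l ! i = y i" if "i \<le> n" for i
      using that by (simp add: l_def nth_append del: upt_Suc)
    have "l ! Suc n = k - (\<Sum>i\<le>n. y i)"
      by (simp add: l_def nth_append)
    then have "sum_list l = k"
      using sum_list_split_last[OF len] ly le by simp
    moreover have "l ! p = 0" using ly[OF p(1)] yc[OF p(1)] by simp
    ultimately have "l \<in> ?A" using len p by (auto simp: weak_compositions_def)
    moreover have "x = ?f l"
    proof
      fix i show "x i = ?f l i"
        using ly yc by (auto simp: x simplex_point_def)
    qed
    ultimately show "x \<in> ?f ` ?A" by blast
  qed
qed

text \<open>
  Lowering each of the first \<open>n + 1\<close> entries by one reduces this count to that of all weak
  compositions of \<open>k - (n + 1)\<close>; the last entry is the slack and may be \<open>0\<close>.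
\<close>

lemma card_positive_weak_compositions:
  "card {l \<in> weak_compositions (n + 2) k. \<forall>i\<le>n. l ! i \<noteq> 0} = k choose (n + 1)" (is "card ?A = _")
proof (cases "n + 1 \<le> k")
  case False
  have "?A = {}"
  proof (rule ccontr)
    assume "?A \<noteq> {}"
    then obtain l where len: "length l = n + 2" and s: "sum_list l = k" and pos: "\<forall>i\<le>n. l ! i \<noteq> 0"
      by (auto simp: weak_compositions_def)
    have "(\<Sum>i\<le>n. 1) \<le> (\<Sum>i\<le>n. l ! i)"
      using pos by (intro sum_mono) (auto simp: Suc_le_eq)
    then show False using False s sum_list_split_last[OF len] by simp
  qed
  then show ?thesis using False by (simp add: binomial_eq_0)
next
  case True
  let ?up = "\<lambda>l::nat list. map Suc (butlast l) @ [last l]"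
  let ?dn = "\<lambda>l::nat list. map (\<lambda>x. x - 1) (butlast l) @ [last l]"
  have S: "sum_list (map Suc xs) = sum_list xs + length xs" for xs
    by (induction xs) auto
  have split: "sum_list l = sum_list (butlast l) + last l" if "l \<noteq> []" for l :: "nat list"
    using that by (metis append_butlast_last_id sum_list.Cons sum_list.Nil sum_list_append add_0_right)
  have updn: "map Suc (map (\<lambda>x. x - 1) xs) = xs" if "0 \<notin> set xs" for xs
    using that by (induction xs) auto
  have "bij_betw ?up (weak_compositions (n + 2) (k - (n + 1))) ?A"
  proof (rule bij_betw_byWitness[where f' = ?dn])
    show "\<forall>l\<in>weak_compositions (n + 2) (k - (n + 1)). ?dn (?up l) = l"
      by (auto simp: weak_compositions_def comp_def length_Suc_conv)
    show "\<forall>l\<in>?A. ?up (?dn l) = l"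
    proof
      fix l assume l: "l \<in> ?A"
      then have "0 \<notin> set (butlast l)"
        by (auto simp: weak_compositions_def in_set_conv_nth nth_butlast less_Suc_eq_le)
      then have "?up (?dn l) = butlast l @ [last l]" using updn by simp
      also have "\<dots> = l" using l by (intro append_butlast_last_id) (auto simp: weak_compositions_def)
      finally show "?up (?dn l) = l" .
    qed
    show "?up ` weak_compositions (n + 2) (k - (n + 1)) \<subseteq> ?A"
    proof clarify
      fix l assume "l \<in> weak_compositions (n + 2) (k - (n + 1))"
      then have len: "length l = n + 2" and s: "sum_list l = k - (n + 1)"
        by (auto simp: weak_compositions_def)
      have "sum_list (butlast l) + last l = k - (n + 1)" using split[of l] len s by fastforce
      then show "?up l \<in> weak_compositions (n + 2) k \<and> (\<forall>i\<le>n. ?up l ! i \<noteq> 0)"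
        using len True by (auto simp: weak_compositions_def S nth_append)
    qed
    show "?dn ` ?A \<subseteq> weak_compositions (n + 2) (k - (n + 1))"
    proof clarify
      fix l assume "l \<in> weak_compositions (n + 2) k" "\<forall>i\<le>n. l ! i \<noteq> 0"
      then have len: "length l = n + 2" and s: "sum_list l = k" and "0 \<notin> set (butlast l)"
        by (auto simp: weak_compositions_def in_set_conv_nth nth_butlast less_Suc_eq_le)
      then have "sum_list (butlast l) = sum_list (map (\<lambda>x. x - 1) (butlast l)) + (n + 1)"
        using S[of "map (\<lambda>x. x - 1) (butlast l)"] updn[of "butlast l"] by simp
      moreover have "sum_list (butlast l) + last l = k" using split[of l] len s by fastforce
      ultimately show "?dn l \<in> weak_compositions (n + 2) (k - (n + 1))"
        using len by (auto simp: weak_compositions_def)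
    qed
  qed
  then have "card ?A = card (weak_compositions (Suc (n + 1)) (k - (n + 1)))"
    by (simp add: bij_betw_same_card)
  also have "\<dots> = k choose (k - (n + 1))"
    unfolding card_weak_compositions using True by simp
  also have "\<dots> = k choose (n + 1)"
    using True by (rule binomial_symmetric[symmetric])
  finally show ?thesis .
qed

text \<open>
  Lists with a \<open>0\<close> among the first \<open>n + 1\<close> entries correspond to lattice points, and
  \<open>card_positive_weak_compositions\<close> counts all other weak compositions of \<open>k\<close>.
\<close>

lemma lattice_count_S1:
  assumes "k \<ge> 1"
  shows "lattice_count n (S1 n) k + (k choose (n + 1)) = (k + n + 1) choose (n + 1)"
proof -
  let ?W = "weak_compositions (n + 2) k"
  let ?A = "{l \<in> ?W. \<exists>i\<le>n. l ! i = 0}" and ?P = "{l \<in> ?W. \<forall>i\<le>n. l ! i \<noteq> 0}"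
  have "lattice_count n (S1 n) k = card ?A"
    unfolding lattice_count_def using bij_betw_same_card[OF lattice_points_dilate_S1[OF assms]] by simp
  moreover have "card ?A + card ?P = card (?A \<union> ?P)"
    by (rule card_Un_disjoint[symmetric]) auto
  moreover have "?A \<union> ?P = weak_compositions (Suc (n + 1)) k" by auto
  moreover have "card (weak_compositions (Suc (n + 1)) k) = (k + n + 1) choose (n + 1)"
    unfolding card_weak_compositions using binomial_symmetric[of k "k + (n + 1)"] by simp
  ultimately show ?thesis using card_positive_weak_compositions[of n k] by simp
qed

section \<open>The Ehrhart polynomial and the line of its roots\<close>

text \<open>
  The two binomial coefficients of \<open>lattice_count_S1\<close> are polynomials in \<open>k\<close>, with a rising and a
  falling factorial as numerators.
\<close>

lemma poly_ehrhart_S1: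
  "poly (ehrhart_poly n (S1 n)) s =
    ((\<Prod>j\<le>n. s + 1 + of_nat j) - (\<Prod>j\<le>n. s - of_nat j)) / fact (n + 1)"
proof -
  define p :: "complex poly" where
    "p = smult (1 / fact (n + 1)) ((\<Prod>j\<le>n. [:1 + of_nat j, 1:]) - (\<Prod>j\<le>n. [:- of_nat j, 1:]))"
  have p: "poly p s = ((\<Prod>j\<le>n. s + 1 + of_nat j) - (\<Prod>j\<le>n. s - of_nat j)) / fact (n + 1)" for s
    by (simp add: p_def poly_prod add.commute add.left_commute del: fact_Suc)
  have gb: "poly p s = ((s + of_nat (n + 1)) gchoose (n + 1)) - (s gchoose (n + 1))" for s
  proof -
    have "(s + of_nat (n + 1)) gchoose (n + 1) = (\<Prod>j\<le>n. s + 1 + of_nat j) / fact (n + 1)"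
      by (simp add: gbinomial_pochhammer' pochhammer_prod atLeast0LessThan lessThan_Suc_atMost)
    moreover have "s gchoose (n + 1) = (\<Prod>j\<le>n. s - of_nat j) / fact (n + 1)"
      unfolding gbinomial_prod_rev by (simp add: atLeast0LessThan lessThan_Suc_atMost)
    ultimately show ?thesis unfolding p by (simp only: diff_divide_distrib)
  qed
  have "ehrhart_poly n (S1 n) = p"
  proof (rule ehrhart_poly_eqI)
    fix k :: nat assume "k \<ge> 1"
    then have "lattice_count n (S1 n) k + (k choose (n + 1)) = (k + (n + 1)) choose (n + 1)"
      using lattice_count_S1[of k n] by (simp add: add.assoc)
    then have "of_nat (lattice_count n (S1 n) k) + (of_nat (k choose (n + 1)) :: complex) =
        of_nat ((k + (n + 1)) choose (n + 1))"
      by (simp only: flip: of_nat_add)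
    then show "poly p (of_nat k) = of_nat (lattice_count n (S1 n) k)"
      unfolding gb binomial_gbinomial by (simp add: algebra_simps)
  qed
  then show ?thesis using p by simp
qed

lemma ehrhart_S1_root_iff:
  "poly (ehrhart_poly n (S1 n)) s = 0 \<longleftrightarrow>
    (\<Prod>j\<le>n. s + 1 + of_nat j) = (\<Prod>j\<le>n. s - of_nat j)"
  by (simp add: poly_ehrhart_S1 del: fact_Suc)

text \<open>
  The line \<open>Re s = -1/2\<close> is the perpendicular bisector of each pair \<open>j\<close>, \<open>-1 - j\<close>. Off this line
  \<open>s\<close> is closer to the same member of every pair, so the two products in the root equation
  have different absolute values.
\<close>

lemma ehrhart_S1_root_Re:
  assumes "poly (ehrhart_poly n (S1 n)) s = 0"
  shows "Re s = - 1 / 2"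
proof -
  let ?f = "\<lambda>j. cmod (s + 1 + of_nat j)" and ?g = "\<lambda>j. cmod (s - of_nat j)"
  have eq: "(\<Prod>j\<le>n. ?f j) = (\<Prod>j\<le>n. ?g j)"
    using assms unfolding ehrhart_S1_root_iff prod_norm by simp
  have sq: "(?f j)\<^sup>2 - (?g j)\<^sup>2 = (2 * real j + 1) * (2 * Re s + 1)" for j
    unfolding cmod_power2 by (simp add: power2_eq_square algebra_simps)
  have less: "?f j < ?g j" if "2 * Re s + 1 < 0" for j
  proof (rule power2_less_imp_less)
    have "(2 * real j + 1) * (2 * Re s + 1) < 0" using that by (intro mult_pos_neg) auto
    with sq[of j] show "(?f j)\<^sup>2 < (?g j)\<^sup>2" by linarith
  qed simp
  have greater: "?g j < ?f j" if "2 * Re s + 1 > 0" for j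
  proof (rule power2_less_imp_less)
    have "(2 * real j + 1) * (2 * Re s + 1) > 0" using that by (intro mult_pos_pos) auto
    with sq[of j] show "(?g j)\<^sup>2 < (?f j)\<^sup>2" by linarith
  qed simp
  have "\<not> 2 * Re s + 1 < 0"
  proof
    assume "2 * Re s + 1 < 0"
    note l = less[OF this]
    have "(\<Prod>j\<le>n. ?f j) < (\<Prod>j\<le>n. ?g j)"
    proof (rule prod_mono_strict[of 0])
      show "0 < ?g j" for j using l[of j] norm_ge_zero[of "s + 1 + of_nat j"] by linarith
    qed (use l l[of 0] in \<open>auto intro: less_imp_le\<close>)
    with eq show False by simp
  qed
  moreover have "\<not> 2 * Re s + 1 > 0"
  proof
    assume "2 * Re s + 1 > 0"
    note l = greater[OF this]
    have "(\<Prod>j\<le>n. ?g j) < (\<Prod>j\<le>n. ?f j)"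
    proof (rule prod_mono_strict[of 0])
      show "0 < ?f j" for j using l[of j] norm_ge_zero[of "s - of_nat j"] by linarith
    qed (use l l[of 0] in \<open>auto intro: less_imp_le\<close>)
    with eq show False by simp
  qed
  ultimately show ?thesis by linarith
qed

section \<open>Roots on the critical line and the phase function\<close>

text \<open>
  For \<open>t > 0\<close> this is a continuous choice of the argument of the product of the numbers
  \<open>t + \<i> (j + 1/2)\<close> with \<open>j \<le> n\<close>.
\<close>

definition phase :: "nat \<Rightarrow> real \<Rightarrow> real" where
  "phase n t = (\<Sum>j\<le>n. arctan ((real j + 1 / 2) / t))"

lemma prod_rcis: "(\<Prod>j\<in>A. rcis (r j) (a j)) = rcis (\<Prod>j\<in>A. r j) (\<Sum>j\<in>A. a j)"
  by (induction A rule: infinite_finite_induct) (auto simp: rcis_mult)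

lemma Complex_eq_rcis_arctan:
  assumes "t > 0"
  shows "Complex t a = rcis (t * sqrt (1 + (a / t)\<^sup>2)) (arctan (a / t))"
proof -
  have "sqrt (1 + (a / t)\<^sup>2) > 0" by (simp add: add_pos_nonneg)
  then show ?thesis using assms
    by (simp add: complex_eq_iff cos_arctan sin_arctan)
qed

text \<open>
  At \<open>s = -1/2 + \<i> t\<close> the factors \<open>s - j\<close> and \<open>s + 1 + j\<close> are \<open>\<i>\<close> times \<open>t + \<i> (j + 1/2)\<close> and \<open>\<i>\<close> times
  its conjugate. The root equation thus says that the product of the \<open>t + \<i> (j + 1/2)\<close> is real.
\<close>

lemma ehrhart_S1_root_iff_sin_phase:
  assumes "t > 0"
  shows "poly (ehrhart_poly n (S1 n)) (Complex (- 1 / 2) t) = 0 \<longleftrightarrow> sin (phase n t) = 0"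
proof -
  let ?w = "\<lambda>j. Complex t (real j + 1 / 2)"
  let ?r = "\<lambda>j. t * sqrt (1 + ((real j + 1 / 2) / t)\<^sup>2)"
  have minus: "Complex (- 1 / 2) t - of_nat j = \<i> * ?w j"
    and plus: "Complex (- 1 / 2) t + 1 + of_nat j = \<i> * cnj (?w j)" for j
    by (auto simp: complex_eq_iff)
  have cnj_fixed: "cnj z = z \<longleftrightarrow> Im z = 0" for z
    by (simp add: complex_eq_iff)
  have r: "(\<Prod>j\<le>n. ?r j) > 0"
    using assms by (intro prod_pos mult_pos_pos ballI) (auto simp: add_pos_nonneg)
  have P: "(\<Prod>j\<le>n. ?w j) = rcis (\<Prod>j\<le>n. ?r j) (phase n t)"
    unfolding phase_def prod_rcis[symmetric] using Complex_eq_rcis_arctan[OF assms]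
    by (intro prod.cong) auto
  have "poly (ehrhart_poly n (S1 n)) (Complex (- 1 / 2) t) = 0 \<longleftrightarrow>
      cnj (\<Prod>j\<le>n. ?w j) = (\<Prod>j\<le>n. ?w j)"
    unfolding ehrhart_S1_root_iff minus plus by (simp add: prod.distrib)
  also have "\<dots> \<longleftrightarrow> Im (\<Prod>j\<le>n. ?w j) = 0"
    using cnj_fixed by this
  also have "\<dots> \<longleftrightarrow> sin (phase n t) = 0"
    unfolding P Im_rcis using less_imp_neq[OF r] by (metis mult_eq_0_iff)
  finally show ?thesis .
qed

lemma ehrhart_S1_root_uminus_Im:
  "poly (ehrhart_poly n (S1 n)) (Complex x (- y)) = 0 \<longleftrightarrow>
    poly (ehrhart_poly n (S1 n)) (Complex x y) = 0"
proof -
  have "Complex x (- y) = cnj (Complex x y)" by (simp add: complex_eq_iff)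
  then have "poly (ehrhart_poly n (S1 n)) (Complex x (- y)) =
      cnj (poly (ehrhart_poly n (S1 n)) (Complex x y))"
    by (simp only: poly_ehrhart_S1) simp
  then show ?thesis by simp
qed

section \<open>The root of largest imaginary part\<close>

lemma sum_half_odd: "(\<Sum>j\<le>n. real j + 1 / 2) = (real n + 1)\<^sup>2 / 2"
  by (induction n) (auto simp: power2_eq_square field_simps)

lemma sum_half_odd_cubed_le: "(\<Sum>j\<le>n. (real j + 1 / 2) ^ 3) \<le> (real n + 1) ^ 4 / 4"
proof -
  have "(\<Sum>j\<le>n. (real j + 1 / 2) ^ 3) = (real n + 1)\<^sup>2 * (2 * (real n + 1)\<^sup>2 - 1) / 8"
    by (induction n) (auto simp: field_simps power2_eq_square power3_eq_cube)
  also have "\<dots> = (real n + 1) ^ 4 / 4 - (real n + 1)\<^sup>2 / 8"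
    by (simp add: field_simps power2_eq_square power4_eq_xxxx)
  finally show ?thesis by simp
qed

lemma arctan_ge_cubic:
  assumes "0 \<le> x"
  shows "x - x ^ 3 / 3 \<le> arctan x"
proof -
  let ?g = "\<lambda>x::real. arctan x - x + x ^ 3 / 3"
  have "?g 0 \<le> ?g x"
  proof (rule DERIV_nonneg_imp_nondecreasing[OF assms])
    fix y :: real
    have "(?g has_real_derivative (inverse (1 + y\<^sup>2) - 1 + y\<^sup>2)) (at y)"
      by (auto intro!: derivative_eq_intros)
    moreover have "inverse (1 + y\<^sup>2) - 1 + y\<^sup>2 = y ^ 4 / (1 + y\<^sup>2)"
      by (simp add: add_nonneg_eq_0_iff divide_simps) (simp add: power2_eq_square power4_eq_xxxx algebra_simps)
    moreover have "\<dots> \<ge> 0" by simp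
    ultimately show "\<exists>D. (?g has_real_derivative D) (at y) \<and> 0 \<le> D" by metis
  qed
  then show ?thesis by simp
qed

lemma phase_pos: "t > 0 \<Longrightarrow> phase n t > 0"
  unfolding phase_def by (intro sum_pos) auto

lemma phase_le:
  assumes "t > 0"
  shows "phase n t \<le> (real n + 1)\<^sup>2 / (2 * t)"
proof -
  have "phase n t \<le> (\<Sum>j\<le>n. (real j + 1 / 2) / t)"
    unfolding phase_def using assms by (intro sum_mono arctan_le_self) auto
  also have "\<dots> = (real n + 1)\<^sup>2 / (2 * t)"
    unfolding sum_divide_distrib[symmetric] sum_half_odd by simp
  finally show ?thesis .
qed

lemma phase_ge:
  assumes "t > 0"
  shows "phase n t \<ge> (real n + 1)\<^sup>2 / (2 * t) - (real n + 1) ^ 4 / (12 * t ^ 3)"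
proof -
  have "(real n + 1)\<^sup>2 / (2 * t) - (real n + 1) ^ 4 / (12 * t ^ 3) =
      (\<Sum>j\<le>n. real j + 1 / 2) / t - ((real n + 1) ^ 4 / 4) / (3 * t ^ 3)"
    unfolding sum_half_odd by simp
  also have "\<dots> \<le> (\<Sum>j\<le>n. real j + 1 / 2) / t - (\<Sum>j\<le>n. (real j + 1 / 2) ^ 3) / (3 * t ^ 3)"
    using assms by (intro diff_left_mono divide_right_mono sum_half_odd_cubed_le) auto
  also have "\<dots> = (\<Sum>j\<le>n. (real j + 1 / 2) / t - ((real j + 1 / 2) / t) ^ 3 / 3)"
    by (simp only: sum_divide_distrib sum_subtractf power_divide) (simp add: mult.commute)
  also have "\<dots> \<le> phase n t"
    unfolding phase_def using assms by (intro sum_mono arctan_ge_cubic) auto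
  finally show ?thesis .
qed

text \<open>
  Beyond the bound the phase lies strictly between \<open>0\<close> and \<open>\<pi>\<close>.
\<close>

lemma ehrhart_S1_root_Im_le:
  assumes "poly (ehrhart_poly n (S1 n)) (Complex (- 1 / 2) t) = 0" "t > 0"
  shows "t \<le> (real n + 1)\<^sup>2 / (2 * pi)"
proof (rule ccontr)
  assume "\<not> ?thesis"
  then have "(real n + 1)\<^sup>2 / (2 * t) < pi" using assms(2) by (simp add: field_simps)
  with phase_le[OF assms(2), of n] have "phase n t < pi" by linarith
  then have "sin (phase n t) > 0" using phase_pos[OF assms(2)] by (intro sin_gt_zero) auto
  moreover have "sin (phase n t) = 0"
    using assms ehrhart_S1_root_iff_sin_phase by blast
  ultimately show False by simp
qed

text \<open>
  By \<open>arctan x \<le> x\<close> the phase is at most \<open>\<pi>\<close> at \<open>T\<close>. Going down to \<open>T - 2\<close> raises the linear term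
  \<open>\<pi> T / t\<close> by about \<open>2 \<pi> / T\<close>, while the cubic error term of the arctangents is only about
  \<open>\<pi>\<^sup>2 / (3 T)\<close>. As \<open>\<pi> < 6\<close>, the phase is at least \<open>\<pi>\<close> at \<open>T - 2\<close> for large \<open>T\<close>, and by continuity it
  equals \<open>\<pi>\<close> in between.
\<close>

lemma ehrhart_S1_large_root:
  fixes n :: nat
  defines "T \<equiv> (real n + 1)\<^sup>2 / (2 * pi)"
  assumes T: "T \<ge> 8"
  shows "\<exists>t. T - 2 \<le> t \<and> poly (ehrhart_poly n (S1 n)) (Complex (- 1 / 2) t) = 0"
proof -
  define u where "u = T - 2"
  have u: "u \<ge> 6" using T by (simp add: u_def)
  have N: "(real n + 1)\<^sup>2 = 2 * pi * (u + 2)" by (simp add: T_def u_def)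
  have "phase n u \<ge> pi * (u + 2) / u - pi\<^sup>2 * (u + 2)\<^sup>2 / (3 * u ^ 3)"
  proof -
    have "(real n + 1) ^ 4 = ((real n + 1)\<^sup>2)\<^sup>2" by simp
    then have "(real n + 1) ^ 4 = 4 * (pi\<^sup>2 * (u + 2)\<^sup>2)"
      unfolding N by (simp add: power_mult_distrib)
    then show ?thesis using phase_ge[of u n] u unfolding N by (simp add: mult.assoc)
  qed
  moreover have "pi * (u + 2) / u - pi\<^sup>2 * (u + 2)\<^sup>2 / (3 * u ^ 3) \<ge> pi"
  proof -
    (* The bound pi <= 16/5 < 6 leaves room to absorb the shift by 2 once u >= 6. *)
    have "pi * (u + 2)\<^sup>2 \<le> 16 / 5 * (u + 2)\<^sup>2"
      using pi_approx by (intro mult_right_mono) auto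
    also have "\<dots> \<le> 6 * u\<^sup>2"
    proof -
      have "6 * u \<le> u * u" using u by (intro mult_right_mono) auto
      moreover have "16 / 5 * (u + 2)\<^sup>2 = 16 / 5 * (u * u) + 64 / 5 * u + 64 / 5"
        by (simp add: power2_eq_square field_simps)
      ultimately show ?thesis using u unfolding power2_eq_square[of u] by linarith
    qed
    finally have "pi * (pi * (u + 2)\<^sup>2) \<le> pi * (6 * u\<^sup>2)" by (intro mult_left_mono) auto
    then have "pi\<^sup>2 * (u + 2)\<^sup>2 / (3 * u ^ 3) \<le> pi * (6 * u\<^sup>2) / (3 * u ^ 3)"
      using u by (intro divide_right_mono) (auto simp: power2_eq_square mult.assoc)
    also have "\<dots> = 2 * pi / u"
      using u by (simp add: power2_eq_square power3_eq_cube)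
    finally have "pi\<^sup>2 * (u + 2)\<^sup>2 / (3 * u ^ 3) \<le> 2 * pi / u" .
    moreover have "pi * (u + 2) / u = pi + 2 * pi / u" using u by (simp add: field_simps)
    ultimately show ?thesis by linarith
  qed
  ultimately have lo: "pi \<le> phase n u" by linarith
  have hi: "phase n T \<le> pi"
    using phase_le[of T n] T by (simp add: T_def)
  have "\<exists>t\<ge>u. t \<le> T \<and> phase n t = pi"
  proof (rule IVT2')
    show "continuous_on {u..T} (phase n)"
      unfolding phase_def using u by (intro continuous_intros) auto
  qed (use lo hi in \<open>auto simp: u_def\<close>)
  then obtain t where t: "t \<ge> u" "phase n t = pi" by blast
  then show ?thesis using ehrhart_S1_root_iff_sin_phase[of t n] u by (auto simp: u_def)
qed

lemma cmod_half_line: "(cmod (Complex (- 1 / 2) t))\<^sup>2 = 1 / 4 + t\<^sup>2"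
  unfolding cmod_power2 by (simp add: power2_eq_square)

text \<open>
  On the line \<open>Re s = -1/2\<close> the norm grows with \<open>\<bar>Im s\<bar>\<close>, so a root of maximal norm has maximal
  \<open>\<bar>Im s\<bar>\<close>; the two preceding lemmas on roots locate this maximum between \<open>T - 2\<close> and \<open>T\<close>, where
  \<open>T = (n + 1)\<^sup>2 / (2 \<pi>)\<close>. The main term of the theorem is \<open>T - 1 / (2 \<pi>)\<close>.
\<close>

lemma max_norm_root_S1_estimate:
  assumes max: "max_norm_root (ehrhart_poly n (S1 n)) z"
    and T: "(real n + 1)\<^sup>2 / (2 * pi) \<ge> 8"
  shows "\<bar>cmod (z + 1 / 2) - real n * (real n + 2) / (2 * pi)\<bar> \<le> 2"
proof -
  let ?T = "(real n + 1)\<^sup>2 / (2 * pi)"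
  have z0: "poly (ehrhart_poly n (S1 n)) z = 0"
    and zmax: "\<And>w. poly (ehrhart_poly n (S1 n)) w = 0 \<Longrightarrow> cmod w \<le> cmod z"
    using max by (auto simp: max_norm_root_def)
  have z: "z = Complex (- 1 / 2) (Im z)"
    using ehrhart_S1_root_Re[OF z0] by (simp add: complex_eq_iff)
  have norm: "cmod (z + 1 / 2) = \<bar>Im z\<bar>"
    by (subst z) (simp add: cmod_def)
  obtain t where t: "?T - 2 \<le> t" "poly (ehrhart_poly n (S1 n)) (Complex (- 1 / 2) t) = 0"
    using ehrhart_S1_large_root[OF T] by blast
  have "(cmod (Complex (- 1 / 2) t))\<^sup>2 \<le> (cmod (Complex (- 1 / 2) (Im z)))\<^sup>2"
    using zmax[OF t(2)] z by (intro power_mono) auto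
  then have "\<bar>t\<bar> \<le> \<bar>Im z\<bar>"
    unfolding cmod_half_line by (simp add: abs_le_square_iff)
  then have lower: "?T - 2 \<le> \<bar>Im z\<bar>" using t(1) by linarith
  moreover have "\<bar>Im z\<bar> \<le> ?T"
  proof (rule ehrhart_S1_root_Im_le)
    show "poly (ehrhart_poly n (S1 n)) (Complex (- 1 / 2) \<bar>Im z\<bar>) = 0"
      using z0 z ehrhart_S1_root_uminus_Im[of n "- 1 / 2" "Im z"] by (auto simp: abs_if)
    show "\<bar>Im z\<bar> > 0" using lower T by linarith
  qed
  moreover have "real n * (real n + 2) / (2 * pi) = ?T - 1 / (2 * pi)"
    by (simp add: field_simps power2_eq_square)
  moreover have "0 \<le> 1 / (2 * pi)" "1 / (2 * pi) \<le> 1"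
    using pi_gt3 by (auto simp: field_simps)
  ultimately show ?thesis unfolding norm by linarith
qed

theorem theorem1p7:
  shows "(\<forall>n\<ge>1. \<forall>s::complex. poly (ehrhart_poly n (S1 n)) s = 0 \<longrightarrow> Re s = - 1 / 2) \<and>
    (\<forall>\<alpha> :: nat \<Rightarrow> complex.
       (\<forall>n\<ge>1. max_norm_root (ehrhart_poly n (S1 n)) (\<alpha> n)) \<longrightarrow>
       (\<lambda>n. cmod (\<alpha> n + 1 / 2) - real n * (real n + 2) / (2 * pi)) \<in> o(\<lambda>n. real n))"
proof (intro conjI allI impI)
  fix n :: nat and s :: complex
  assume "poly (ehrhart_poly n (S1 n)) s = 0"
  then show "Re s = - 1 / 2" by (rule ehrhart_S1_root_Re)
next
  fix \<alpha> :: "nat \<Rightarrow> complex"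
  assume \<alpha>: "\<forall>n\<ge>1. max_norm_root (ehrhart_poly n (S1 n)) (\<alpha> n)"
  let ?d = "\<lambda>n. cmod (\<alpha> n + 1 / 2) - real n * (real n + 2) / (2 * pi)"
  have "\<forall>\<^sub>F n in sequentially. norm (?d n) \<le> 2 * norm (1 :: real)"
  proof (rule eventually_sequentiallyI)
    (* Any n with (n + 1)^2 >= 64 would do, since 2 pi < 8; the estimate needs T >= 8. *)
    fix n :: nat assume n: "n \<ge> 10"
    have "(11 :: real)\<^sup>2 \<le> (real n + 1)\<^sup>2" using n by (intro power_mono) auto
    then have "(real n + 1)\<^sup>2 / (2 * pi) \<ge> 8"
      using pi_less_4 by (simp add: field_simps)
    then show "norm (?d n) \<le> 2 * norm (1 :: real)"
      using max_norm_root_S1_estimate[of n "\<alpha> n"] \<alpha> n by simp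
  qed
  then have "?d \<in> O(\<lambda>_. 1 :: real)" by (rule bigoI)
  moreover have "(\<lambda>_. 1 :: real) \<in> o(\<lambda>n. real n)"
    by (intro smalloI_tendsto tendsto_divide_0[OF tendsto_const]
        filterlim_at_top_imp_at_infinity filterlim_real_sequentially
        eventually_sequentiallyI[of 1]) auto
  ultimately show "?d \<in> o(\<lambda>n. real n)" by (rule landau_o.big_small_trans)
qed

end
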